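(* Let $A$ be a bounded operator on $\ell^2$ that is represented by the tridiagonal matrix with parameters $(a_n)_{n\ge1}$, $(b_n)_{n\ge0}$ in the orthogonal basis $\{e_n\}_{n\ge 0}$, with $\|e_n\|=h_n$, as described in the context. Suppose that $\lambda\in\mathbb{C}$ is not an eigenvalue of $A$ and that $\gamma\in\mathbb{C}$ is such that $$\sum_{n=0}^{\infty}|Q_n(\lambda)\gamma-P_n(\lambda)|^2h_n^2<+\infty .$$ Put $r_m(\lambda):=Q_m(\lambda)\gamma-P_m(\lambda)$ for $m\ge 0$. Then $\lambda\in\Omega(A)$ if and only if there are constants $C>0$ and $0<q<1$ such that $$\left|\frac{Q_n(\lambda)r_m(\lambda)}{a_1a_2\cdots a_n}\,\frac{h_m}{h_n}\right|\le Cq^{m-n}\quad\text{for all } 0\le n\le m,$$ $$\left|\frac{Q_m(\lambda)r_n(\lambda)}{a_1a_2\cdots a_n}\,\frac{h_m}{h_n}\right|\le Cq^{n-m}\quad\text{for all } n\ge m\ge 0 .$$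
   Context: $\ell^2$ is the complex Hilbert space of square-summable sequences. $\{e_n\}_{n\ge0}$ is an orthogonal basis of $\ell^2$ with norms $\|e_n\|=h_n>0$ (that is, $\{e_n/h_n\}$ is an orthonormal basis); the basis is not assumed to be normalized. $(a_n)_{n\ge1}$ are nonzero complex numbers and $(b_n)_{n\ge0}$ are complex numbers. $A$ is represented in the basis $\{e_n\}$ by the matrix $$A=\begin{pmatrix} b_0&1&0&0&\cdots\\ a_1&b_1&1&0&\cdots\\ 0&a_2&b_2&1&\cdots\\ \vdots&\vdots&\ddots&\ddots&\ddots\end{pmatrix},$$ i.e. $Ae_0=b_0e_0+a_1e_1$ and $Ae_n=e_{n-1}+b_ne_n+a_{n+1}e_{n+1}$ for $n\ge1$; $A$ is assumed to extend to a bounded operator on all of $\ell^2$, still denoted $A$. The polynomials $Q_n,P_n$ in $\lambda$ are the solutions of the recurrence $a_ny_{n-1}+b_ny_n+y_{n+1}=\lambda y_n$ for $n\ge1$ with initial values $Q_0=1$, $Q_1=\lambda-b_0$ and $P_0=0$, $P_1=1$. (They are the denominators and numerators of the convergents of the continued fraction $\frac{1|}{|\lambda-b_0}-\frac{a_1|}{|\lambda-b_1}-\frac{a_2|}{|\lambda-b_2}-\cdots$.) $\Omega(A)=\mathbb{C}\setminus\sigma(A)$ is the resolvent set of $A$, where $\sigma(A)$ is the spectrum. The empty product $a_1\cdots a_n$ for $n=0$ equals $1$. *)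

theory Defs
  imports "HOL-Analysis.Analysis" "HOL-Computational_Algebra.Polynomial"
begin

section \<open>The complex Hilbert space of square-summable sequences\<close>

typedef ell2 = "{x :: nat \<Rightarrow> complex. summable (\<lambda>n. (cmod (x n))\<^sup>2)}"
  morphisms coord Abs_ell2
  by (rule exI [of _ "\<lambda>_. 0"]) simp

setup_lifting type_definition_ell2

lemma summable_coord: "summable (\<lambda>n. (cmod (coord x n))\<^sup>2)"
  using coord [of x] by simp

lemma ell2_eqI: "(\<And>n. coord x n = coord y n) \<Longrightarrow> x = y"
  by (simp add: coord_inject [symmetric] fun_eq_iff)

lemma cmod_add_square_le: "(cmod (x + y))\<^sup>2 \<le> 2 * (cmod x)\<^sup>2 + 2 * (cmod y)\<^sup>2"
proof -
  have "(cmod (x + y))\<^sup>2 \<le> (cmod x + cmod y)\<^sup>2"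
    by (simp add: norm_triangle_ineq power_mono)
  also have "\<dots> \<le> 2 * (cmod x)\<^sup>2 + 2 * (cmod y)\<^sup>2"
    using sum_squares_bound [of "cmod x" "cmod y"] by (simp add: power2_sum)
  finally show ?thesis .
qed

lemma summable_square_add:
  assumes "summable (\<lambda>n. (cmod (x n))\<^sup>2)" "summable (\<lambda>n. (cmod (y n))\<^sup>2)"
  shows "summable (\<lambda>n. (cmod (x n + y n))\<^sup>2)"
proof (rule summable_comparison_test')
  show "summable (\<lambda>n. 2 * (cmod (x n))\<^sup>2 + 2 * (cmod (y n))\<^sup>2)"
    by (intro summable_add summable_mult assms)
  show "norm ((cmod (x n + y n))\<^sup>2) \<le> 2 * (cmod (x n))\<^sup>2 + 2 * (cmod (y n))\<^sup>2" if "n \<ge> 0" for n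
    using cmod_add_square_le by simp
qed

lemma summable_square_mult:
  assumes "summable (\<lambda>n. (cmod (x n))\<^sup>2)"
  shows "summable (\<lambda>n. (cmod (c * x n))\<^sup>2)"
  using summable_mult [OF assms, of "(cmod c)\<^sup>2"] by (simp add: norm_mult power_mult_distrib)

lift_definition scaleC :: "complex \<Rightarrow> ell2 \<Rightarrow> ell2"  (infixr "*\<^sub>C" 75)
  is "\<lambda>c x n. c * x n"
  by (rule summable_square_mult)

instantiation ell2 :: real_vector
begin

lift_definition zero_ell2 :: ell2 is "\<lambda>_. 0" by simp
lift_definition plus_ell2 :: "ell2 \<Rightarrow> ell2 \<Rightarrow> ell2" is "\<lambda>x y n. x n + y n"
  by (rule summable_square_add)
lift_definition uminus_ell2 :: "ell2 \<Rightarrow> ell2" is "\<lambda>x n. - x n" by simp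
lift_definition minus_ell2 :: "ell2 \<Rightarrow> ell2 \<Rightarrow> ell2" is "\<lambda>x y n. x n - y n"
  using summable_square_add [where y = "\<lambda>n. - y n" for y] by simp
lift_definition scaleR_ell2 :: "real \<Rightarrow> ell2 \<Rightarrow> ell2" is "\<lambda>c x n. of_real c * x n"
  by (rule summable_square_mult)

instance
  by (intro_classes; transfer) (auto simp: fun_eq_iff algebra_simps)

end

lemma vector_space_scaleC: "vector_space scaleC"
  by (unfold_locales; transfer) (auto simp: fun_eq_iff algebra_simps)

definition cinner :: "ell2 \<Rightarrow> ell2 \<Rightarrow> complex"
  where "cinner x y = (\<Sum>n. coord x n * cnj (coord y n))"

lemma summable_cinner: "summable (\<lambda>n. coord x n * cnj (coord y n))"
proof (rule summable_comparison_test')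
  show "summable (\<lambda>n. (cmod (coord x n))\<^sup>2 + (cmod (coord y n))\<^sup>2)"
    by (intro summable_add summable_coord)
  show "norm (coord x n * cnj (coord y n)) \<le> (cmod (coord x n))\<^sup>2 + (cmod (coord y n))\<^sup>2"
    if "n \<ge> 0" for n
  proof -
    have "0 \<le> cmod (coord x n) * cmod (coord y n)" by simp
    then show ?thesis
      using sum_squares_bound [of "cmod (coord x n)" "cmod (coord y n)"]
      unfolding norm_mult complex_mod_cnj by linarith
  qed
qed

lemma cinner_add_left: "cinner (x + y) z = cinner x z + cinner y z"
  by (simp add: cinner_def plus_ell2.rep_eq ring_distribs suminf_add summable_cinner)

lemma cinner_scaleC_left: "cinner (c *\<^sub>C x) y = c * cinner x y"
  by (simp add: cinner_def scaleC.rep_eq mult.assoc suminf_mult summable_cinner)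

lemma cinner_commute: "cinner x y = cnj (cinner y x)"
proof -
  have "(\<lambda>n. cnj (coord y n * cnj (coord x n))) sums cnj (cinner y x)"
    unfolding cinner_def sums_cnj by (rule summable_sums [OF summable_cinner])
  then show ?thesis
    by (simp add: cinner_def sums_iff mult.commute)
qed

lemma cinner_self: "cinner x x = of_real (\<Sum>n. (cmod (coord x n))\<^sup>2)"
  unfolding cinner_def suminf_of_real [OF summable_coord] by (simp only: complex_norm_square)

lemma scaleR_scaleC: "r *\<^sub>R x = of_real r *\<^sub>C (x :: ell2)"
  by transfer simp

instantiation ell2 :: real_inner
begin

definition inner_ell2 :: "ell2 \<Rightarrow> ell2 \<Rightarrow> real" where "inner_ell2 x y = Re (cinner x y)"
definition norm_ell2 :: "ell2 \<Rightarrow> real" where "norm_ell2 x = sqrt (\<Sum>n. (cmod (coord x n))\<^sup>2)"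
definition sgn_ell2 :: "ell2 \<Rightarrow> ell2" where "sgn_ell2 x = x /\<^sub>R norm x"
definition dist_ell2 :: "ell2 \<Rightarrow> ell2 \<Rightarrow> real" where "dist_ell2 x y = norm (x - y)"
definition uniformity_ell2 :: "(ell2 \<times> ell2) filter"
  where "uniformity_ell2 = (INF e\<in>{0 <..}. principal {(x, y). dist x y < e})"
definition open_ell2 :: "ell2 set \<Rightarrow> bool"
  where "open_ell2 U = (\<forall>x\<in>U. eventually (\<lambda>(x', y). x' = x \<longrightarrow> y \<in> U) uniformity)"

instance
proof
  fix x y z :: ell2 and r :: real
  show "inner x y = inner y x"
    by (subst (2) inner_ell2_def, subst cinner_commute) (simp add: inner_ell2_def)
  show "inner (x + y) z = inner x z + inner y z"
    by (simp add: inner_ell2_def cinner_add_left)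
  show "inner (r *\<^sub>R x) y = r * inner x y"
    by (simp add: inner_ell2_def scaleR_scaleC cinner_scaleC_left)
  show "0 \<le> inner x x"
    by (simp add: inner_ell2_def cinner_self suminf_nonneg summable_coord)
  show "(inner x x = 0) = (x = 0)"
    by (auto simp: inner_ell2_def cinner_self suminf_eq_zero_iff summable_coord
        zero_ell2.rep_eq intro!: ell2_eqI)
  show "norm x = sqrt (inner x x)"
    by (simp add: norm_ell2_def inner_ell2_def cinner_self)
qed (simp_all add: sgn_ell2_def dist_ell2_def uniformity_ell2_def open_ell2_def)

end

lemma cinner_norm: "cinner x x = of_real ((norm x)\<^sup>2)"
  by (simp add: cinner_self norm_ell2_def suminf_nonneg summable_coord)

lemma norm_scaleC: "norm (c *\<^sub>C x) = cmod c * norm x"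
  by (simp add: norm_ell2_def scaleC.rep_eq norm_mult power_mult_distrib suminf_mult
      summable_coord real_sqrt_mult)

lemma partial_norm_le: "(\<Sum>n<k. (cmod (coord x n))\<^sup>2) \<le> (norm x)\<^sup>2"
  by (simp add: norm_ell2_def suminf_nonneg summable_coord sum_le_suminf)

lemma norm_coord_le: "cmod (coord x n) \<le> norm x"
proof (rule power2_le_imp_le)
  have "(cmod (coord x n))\<^sup>2 \<le> (\<Sum>n<Suc n. (cmod (coord x n))\<^sup>2)"
    by (simp add: sum_nonneg)
  also have "\<dots> \<le> (norm x)\<^sup>2" by (rule partial_norm_le)
  finally show "(cmod (coord x n))\<^sup>2 \<le> (norm x)\<^sup>2" .
qed simp

instance ell2 :: banach
proof
  fix X :: "nat \<Rightarrow> ell2"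
  assume X: "Cauchy X"
  have "Cauchy (\<lambda>i. coord (X i) n)" for n
  proof (rule metric_CauchyI)
    fix e :: real assume "e > 0"
    then obtain M where M: "\<And>i j. i \<ge> M \<Longrightarrow> j \<ge> M \<Longrightarrow> dist (X i) (X j) < e"
      using X by (meson metric_CauchyD)
    have "dist (coord (X i) n) (coord (X j) n) < e" if "i \<ge> M" "j \<ge> M" for i j
      using norm_coord_le [of "X i - X j" n] M [OF that]
      by (simp add: dist_norm minus_ell2.rep_eq)
    then show "\<exists>M. \<forall>i\<ge>M. \<forall>j\<ge>M. dist (coord (X i) n) (coord (X j) n) < e" by blast
  qed
  then have "\<forall>n. \<exists>l. (\<lambda>i. coord (X i) n) \<longlonglongrightarrow> l"
    using Cauchy_convergent convergent_def by blast
  then obtain l where l: "\<And>n. (\<lambda>i. coord (X i) n) \<longlonglongrightarrow> l n" by metis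
  have part: "\<exists>M. \<forall>i\<ge>M. \<forall>k. (\<Sum>n<k. (cmod (coord (X i) n - l n))\<^sup>2) \<le> e\<^sup>2" if "e > 0" for e
  proof -
    obtain M where M: "\<And>i j. i \<ge> M \<Longrightarrow> j \<ge> M \<Longrightarrow> dist (X i) (X j) < e"
      using X \<open>e > 0\<close> by (meson metric_CauchyD)
    have "(\<Sum>n<k. (cmod (coord (X i) n - l n))\<^sup>2) \<le> e\<^sup>2" if "i \<ge> M" for i k
    proof (rule LIMSEQ_le_const2)
      show "(\<lambda>j. \<Sum>n<k. (cmod (coord (X i) n - coord (X j) n))\<^sup>2)
          \<longlonglongrightarrow> (\<Sum>n<k. (cmod (coord (X i) n - l n))\<^sup>2)"
        by (intro tendsto_intros l)
      have "(\<Sum>n<k. (cmod (coord (X i) n - coord (X j) n))\<^sup>2) \<le> e\<^sup>2" if "j \<ge> M" for j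
      proof -
        have "(\<Sum>n<k. (cmod (coord (X i) n - coord (X j) n))\<^sup>2) \<le> (norm (X i - X j))\<^sup>2"
          using partial_norm_le [of "X i - X j" k] by (simp add: minus_ell2.rep_eq)
        also have "\<dots> \<le> e\<^sup>2"
          using M [OF \<open>i \<ge> M\<close> that] by (intro power_mono) (auto simp: dist_norm)
        finally show ?thesis .
      qed
      then show "\<exists>N. \<forall>j\<ge>N. (\<Sum>n<k. (cmod (coord (X i) n - coord (X j) n))\<^sup>2) \<le> e\<^sup>2" by blast
    qed
    then show ?thesis by blast
  qed
  have summ: "summable (\<lambda>n. (cmod (coord (X i) n - l n))\<^sup>2)"
    if "\<forall>k. (\<Sum>n<k. (cmod (coord (X i) n - l n))\<^sup>2) \<le> e\<^sup>2" for i e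
    using that by (intro summableI_nonneg_bounded) auto
  obtain i0 where "\<forall>k. (\<Sum>n<k. (cmod (coord (X i0) n - l n))\<^sup>2) \<le> 1\<^sup>2"
    using part [of 1] by force
  then have "summable (\<lambda>n. (cmod (coord (X i0) n - l n))\<^sup>2)"
    by (rule summ)
  then have "summable (\<lambda>n. (cmod ((l n - coord (X i0) n) + coord (X i0) n))\<^sup>2)"
    by (intro summable_square_add summable_coord) (simp add: norm_minus_commute)
  then have "l \<in> {x. summable (\<lambda>n. (cmod (x n))\<^sup>2)}" by simp
  then have L: "coord (Abs_ell2 l) = l" by (rule Abs_ell2_inverse)
  have "X \<longlonglongrightarrow> Abs_ell2 l"
  proof (rule metric_LIMSEQ_I)
    fix r :: real assume "r > 0"
    obtain M where M: "\<forall>i\<ge>M. \<forall>k. (\<Sum>n<k. (cmod (coord (X i) n - l n))\<^sup>2) \<le> (r/2)\<^sup>2"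
      using part [of "r/2"] \<open>r > 0\<close> by auto
    have "dist (X i) (Abs_ell2 l) < r" if "i \<ge> M" for i
    proof -
      have "\<forall>k. (\<Sum>n<k. (cmod (coord (X i) n - l n))\<^sup>2) \<le> (r/2)\<^sup>2"
        using M that by blast
      then have "(\<Sum>n. (cmod (coord (X i) n - l n))\<^sup>2) \<le> (r/2)\<^sup>2"
        using summ by (intro suminf_le_const) blast+
      then have "dist (X i) (Abs_ell2 l) \<le> r/2"
        using \<open>r > 0\<close> unfolding dist_norm norm_ell2_def minus_ell2.rep_eq L
        by (intro real_le_lsqrt) simp_all
      then show ?thesis using \<open>r > 0\<close> by simp
    qed
    then show "\<exists>no. \<forall>i\<ge>no. dist (X i) (Abs_ell2 l) < r" by blast
  qed
  then show "convergent X" by (rule convergentI)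
qed

text \<open>The vectors need not be normalized: \<open>e n\<close> is a nonzero multiple of the \<open>n\<close>-th member
  of an orthonormal basis.\<close>

definition orthogonal_basis :: "(nat \<Rightarrow> ell2) \<Rightarrow> bool"
  where "orthogonal_basis e \<longleftrightarrow>
    (\<forall>n. e n \<noteq> 0) \<and> (\<forall>m n. m \<noteq> n \<longrightarrow> cinner (e m) (e n) = 0) \<and>
    closure (module.span scaleC (range e)) = UNIV"

section \<open>Bounded operators and their spectrum\<close>

text \<open>The library's \<^const>\<open>bounded_linear\<close> only asserts linearity over the reals.\<close>

definition bounded_clinear :: "(ell2 \<Rightarrow> ell2) \<Rightarrow> bool"
  where "bounded_clinear A \<longleftrightarrow> bounded_linear A \<and> (\<forall>c x. A (c *\<^sub>C x) = c *\<^sub>C A x)"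

definition eigenvalue :: "(ell2 \<Rightarrow> ell2) \<Rightarrow> complex \<Rightarrow> bool"
  where "eigenvalue A z \<longleftrightarrow> (\<exists>x. x \<noteq> 0 \<and> A x = z *\<^sub>C x)"

definition spectrum :: "(ell2 \<Rightarrow> ell2) \<Rightarrow> complex set"
  where "spectrum A =
    {z. \<not> (\<exists>R. bounded_clinear R \<and>
          (\<forall>x. R (A x - z *\<^sub>C x) = x) \<and> (\<forall>x. A (R x) - z *\<^sub>C R x = x))}"

definition resolvent_set :: "(ell2 \<Rightarrow> ell2) \<Rightarrow> complex set"
  where "resolvent_set A = - spectrum A"

section \<open>Tridiagonal operators and continued fraction convergents\<close>

text \<open>Column \<open>n\<close> of the matrix has \<open>b n\<close> on the diagonal, \<open>1\<close> above and \<open>a (Suc n)\<close> below it;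
  \<open>a 0\<close> is never used.\<close>

definition tridiagonal_in_basis ::
    "(nat \<Rightarrow> complex) \<Rightarrow> (nat \<Rightarrow> complex) \<Rightarrow> (nat \<Rightarrow> ell2) \<Rightarrow> (ell2 \<Rightarrow> ell2) \<Rightarrow> bool"
  where "tridiagonal_in_basis a b e A \<longleftrightarrow>
    A (e 0) = b 0 *\<^sub>C e 0 + a 1 *\<^sub>C e 1 \<and>
    (\<forall>n\<ge>1. A (e n) = e (n - 1) + b n *\<^sub>C e n + a (n + 1) *\<^sub>C e (n + 1))"

text \<open>\<open>denom_poly a b n\<close> and \<open>numer_poly a b n\<close> are the denominator \<open>Q\<^sub>n\<close> and the numerator \<open>P\<^sub>n\<close>
  of the \<open>n\<close>-th convergent; for \<open>n \<ge> 1\<close> both solve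
  \<open>a\<^sub>n y\<^sub>n\<^sub>-\<^sub>1 + b\<^sub>n y\<^sub>n + y\<^sub>n\<^sub>+\<^sub>1 = \<lambda> y\<^sub>n\<close>.\<close>

fun denom_poly :: "(nat \<Rightarrow> complex) \<Rightarrow> (nat \<Rightarrow> complex) \<Rightarrow> nat \<Rightarrow> complex poly" where
  "denom_poly a b 0 = 1"
| "denom_poly a b (Suc 0) = [:- b 0, 1:]"
| "denom_poly a b (Suc (Suc n)) =
    [:- b (Suc n), 1:] * denom_poly a b (Suc n) - smult (a (Suc n)) (denom_poly a b n)"

fun numer_poly :: "(nat \<Rightarrow> complex) \<Rightarrow> (nat \<Rightarrow> complex) \<Rightarrow> nat \<Rightarrow> complex poly" where
  "numer_poly a b 0 = 0"
| "numer_poly a b (Suc 0) = 1"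
| "numer_poly a b (Suc (Suc n)) =
    [:- b (Suc n), 1:] * numer_poly a b (Suc n) - smult (a (Suc n)) (numer_poly a b n)"

lemma
  assumes "n \<ge> 1"
  shows denom_poly_recurrence:
    "a n * poly (denom_poly a b (n - 1)) z + b n * poly (denom_poly a b n) z
      + poly (denom_poly a b (n + 1)) z = z * poly (denom_poly a b n) z"
  and numer_poly_recurrence:
    "a n * poly (numer_poly a b (n - 1)) z + b n * poly (numer_poly a b n) z
      + poly (numer_poly a b (n + 1)) z = z * poly (numer_poly a b n) z"
  using assms by (cases n; simp add: algebra_simps)+

definition remainder ::
    "(nat \<Rightarrow> complex) \<Rightarrow> (nat \<Rightarrow> complex) \<Rightarrow> complex \<Rightarrow> complex \<Rightarrow> nat \<Rightarrow> complex"
  where "remainder a b \<gamma> z m = poly (denom_poly a b m) z * \<gamma> - poly (numer_poly a b m) z"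

end

theory Submission
  imports Defs
begin

text \<open>In the orthonormal basis \<open>u\<^sub>n = e\<^sub>n / h\<^sub>n\<close> put \<open>T = A - \<lambda>\<close>. The two-sided bounds say that the matrix
  \<open>G\<close> whose columns solve \<open>T f = - u\<^sub>n\<close> (by the recurrence off the diagonal, by the Wronskian on it)
  decays exponentially away from the diagonal. If it does, Schur's test bounds \<open>G\<close>, so \<open>T\<close> is onto
  and, being injective, invertible. Conversely, if \<open>T\<close> is invertible, then the columns of \<open>G\<close> are
  those of \<open>- T\<^sup>-\<^sup>1\<close>; since \<open>T\<close> is tridiagonal, conjugating it with the weights \<open>s\<^bsup>min(m, N)\<^esup>\<close>
  for \<open>s\<close> close to \<open>1\<close> is a small perturbation, and the bound on the conjugated inverse, uniform
  in \<open>N\<close>, gives the decay.\<close>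

section \<open>Sesquilinearity of the inner product and the shifted operator\<close>

interpretation scaleC: vector_space scaleC
  by (rule vector_space_scaleC)

lemma cinner_diff_left: "cinner (x - y) z = cinner x z - cinner y z"
  using cinner_add_left [of "x - y" y z] by simp

lemma cinner_zero_left [simp]: "cinner 0 y = 0"
  using cinner_diff_left [of 0 0 y] by simp

lemma cinner_sum_left: "cinner (sum f I) y = (\<Sum>i\<in>I. cinner (f i) y)"
  by (induction I rule: infinite_finite_induct) (auto simp: cinner_add_left)

lemma cinner_scaleR_left: "cinner (r *\<^sub>R x) y = of_real r * cinner x y"
  by (simp add: scaleR_scaleC cinner_scaleC_left)

lemma cinner_scaleC_right: "cinner x (c *\<^sub>C y) = cnj c * cinner x y"
  by (subst (1 2) cinner_commute) (simp add: cinner_scaleC_left)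

lemma bounded_linear_scaleC: "bounded_linear (scaleC c)"
  by (rule bounded_linear_intro [where K = "cmod c"])
     (auto simp: scaleC.scale_right_distrib scaleR_scaleC norm_scaleC mult.commute)

lemma bounded_clinear_shift:
  assumes "bounded_clinear A"
  shows "bounded_clinear (\<lambda>x. A x - z *\<^sub>C x)"
  using assms unfolding bounded_clinear_def
  by (auto intro: bounded_linear_sub bounded_linear_scaleC
      simp: scaleC.scale_right_diff_distrib mult.commute)

lemma bounded_clinear_linear: "bounded_clinear T \<Longrightarrow> bounded_linear T"
  by (simp add: bounded_clinear_def)

section \<open>Coefficients in an orthonormal basis\<close>

locale orthonormal_basis =
  fixes u :: "nat \<Rightarrow> ell2"
  assumes cinner_u: "cinner (u m) (u n) = (if m = n then 1 else 0)"
    and dense: "closure (module.span scaleC (range u)) = UNIV"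
begin

abbreviation coeff :: "ell2 \<Rightarrow> nat \<Rightarrow> complex"
  where "coeff x m \<equiv> cinner x (u m)"

definition partial :: "nat \<Rightarrow> ell2 \<Rightarrow> ell2"
  where "partial N x = (\<Sum>n<N. coeff x n *\<^sub>C u n)"

lemma norm_u: "norm (u n) = 1"
proof -
  have "of_real ((norm (u n))\<^sup>2) = (1 :: complex)"
    by (metis cinner_norm cinner_u)
  then have "(norm (u n))\<^sup>2 = 1"
    using of_real_eq_1_iff by blast
  then show ?thesis
    by (simp add: power2_eq_1_iff) (metis norm_ge_zero not_one_le_zero neg_0_le_iff_le)
qed

lemma norm_sum_basis:
  assumes "finite I"
  shows "(norm (\<Sum>n\<in>I. d n *\<^sub>C u n))\<^sup>2 = (\<Sum>n\<in>I. (cmod (d n))\<^sup>2)"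
  using assms
proof (induction I rule: finite_induct)
  case empty
  then show ?case by simp
next
  case (insert k I)
  have "cinner (\<Sum>n\<in>I. d n *\<^sub>C u n) (d k *\<^sub>C u k) = 0"
    using insert.hyps
    by (auto simp: cinner_sum_left cinner_scaleC_left cinner_scaleC_right cinner_u intro!: sum.neutral)
  then have "inner (d k *\<^sub>C u k) (\<Sum>n\<in>I. d n *\<^sub>C u n) = 0"
    by (subst inner_commute) (simp add: inner_ell2_def)
  then have "(norm (d k *\<^sub>C u k + (\<Sum>n\<in>I. d n *\<^sub>C u n)))\<^sup>2
      = (norm (d k *\<^sub>C u k))\<^sup>2 + (norm (\<Sum>n\<in>I. d n *\<^sub>C u n))\<^sup>2"
    by (rule norm_add_Pythagorean [unfolded orthogonal_def])
  then show ?case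
    using insert by (simp add: norm_scaleC norm_u)
qed

lemma coeff_sum_basis:
  assumes "finite I"
  shows "coeff (\<Sum>n\<in>I. d n *\<^sub>C u n) k = (if k \<in> I then d k else 0)"
proof -
  have "coeff (\<Sum>n\<in>I. d n *\<^sub>C u n) k = (\<Sum>n\<in>I. if n = k then d n else 0)"
    unfolding cinner_sum_left by (rule sum.cong) (auto simp: cinner_scaleC_left cinner_u)
  then show ?thesis
    using assms by simp
qed

lemma coeff_partial: "coeff (partial N x) k = (if k < N then coeff x k else 0)"
  unfolding partial_def by (subst coeff_sum_basis) auto

lemma norm_partial: "(norm (partial N x))\<^sup>2 = (\<Sum>n<N. (cmod (coeff x n))\<^sup>2)"
  unfolding partial_def by (rule norm_sum_basis) simp

text \<open>The residual \<open>x - partial N x\<close> is orthogonal to every \<open>u n\<close>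
  with \<open>n < N\<close>, so Pythagoras applies; this is Bessel's inequality.\<close>

lemma norm_partial_le: "norm (partial N x) \<le> norm x"
proof -
  have "cinner (partial N x) (x - partial N x) = (\<Sum>n<N. coeff x n * cinner (u n) (x - partial N x))"
    by (subst partial_def) (simp add: cinner_sum_left cinner_scaleC_left)
  also have "\<dots> = 0"
  proof (rule sum.neutral, safe)
    fix n assume "n < N"
    have "cinner (u n) (x - partial N x) = cnj (coeff (x - partial N x) n)"
      by (rule cinner_commute)
    then show "coeff x n * cinner (u n) (x - partial N x) = 0"
      using \<open>n < N\<close> by (simp add: cinner_diff_left coeff_partial)
  qed
  finally have "inner (partial N x) (x - partial N x) = 0"
    by (simp add: inner_ell2_def)
  then have "(norm (partial N x + (x - partial N x)))\<^sup>2
      = (norm (partial N x))\<^sup>2 + (norm (x - partial N x))\<^sup>2"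
    by (rule norm_add_Pythagorean [unfolded orthogonal_def])
  then have "(norm (partial N x))\<^sup>2 \<le> (norm x)\<^sup>2"
    by simp
  then show ?thesis
    by (rule power2_le_imp_le) simp
qed

lemma sum_coeff_le: "(\<Sum>n<N. (cmod (coeff x n))\<^sup>2) \<le> (norm x)\<^sup>2"
  unfolding norm_partial [symmetric] by (intro power_mono norm_partial_le) simp

lemma summable_coeff: "summable (\<lambda>n. (cmod (coeff x n))\<^sup>2)"
  by (rule summableI_nonneg_bounded [of _ "(norm x)\<^sup>2"]) (auto intro: sum_coeff_le)

lemma cmod_coeff_le: "cmod (coeff x n) \<le> norm x"
proof (rule power2_le_imp_le)
  have "(cmod (coeff x n))\<^sup>2 \<le> (\<Sum>n<Suc n. (cmod (coeff x n))\<^sup>2)"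
    by (simp add: sum_nonneg)
  then show "(cmod (coeff x n))\<^sup>2 \<le> (norm x)\<^sup>2"
    using sum_coeff_le [where N = "Suc n" and x = x] by linarith
qed simp

lemma bounded_linear_coeff: "bounded_linear (\<lambda>x. coeff x n)"
  by (rule bounded_linear_intro [where K = 1])
     (auto simp: cinner_add_left cinner_scaleR_left scaleR_conv_of_real cmod_coeff_le)

lemma partial_diff: "partial N (x - y) = partial N x - partial N y"
  by (simp add: partial_def cinner_diff_left scaleC.scale_left_diff_distrib sum_subtractf)

lemma partial_fixes_span:
  assumes "y \<in> module.span scaleC (range u)"
  shows "\<exists>N. \<forall>M\<ge>N. partial M y = y"
  using assms
proof (induction rule: scaleC.span_induct_alt)
  case base
  then show ?case by (simp add: partial_def)
next
  case (step c x y)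
  then obtain k N where x: "x = u k" and N: "\<forall>M\<ge>N. partial M y = y"
    by auto
  have "partial M (c *\<^sub>C u k + y) = c *\<^sub>C u k + y" if "M \<ge> max N (Suc k)" for M
  proof -
    have "partial M (c *\<^sub>C u k + y) = (\<Sum>n<M. (c * coeff (u k) n) *\<^sub>C u n) + partial M y"
      by (simp add: partial_def cinner_add_left cinner_scaleC_left scaleC.scale_left_distrib
          sum.distrib)
    also have "(\<Sum>n<M. (c * coeff (u k) n) *\<^sub>C u n) = (\<Sum>n<M. if n = k then c *\<^sub>C u k else 0)"
      by (rule sum.cong) (auto simp: cinner_u)
    also have "\<dots> = c *\<^sub>C u k"
      using that by simp
    finally show ?thesis
      using N that by simp
  qed
  then show ?case
    unfolding x by blast
qed

text \<open>Density supplies a \<open>y\<close> in the span close to \<open>x\<close>. Large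
  truncations reproduce \<open>y\<close> exactly and every truncation is a contraction, so the error
  at \<open>x\<close> is at most twice the distance from \<open>x\<close> to
  \<open>y\<close>.\<close>

lemma partial_tendsto: "(\<lambda>N. partial N x) \<longlonglongrightarrow> x"
proof (rule metric_LIMSEQ_I)
  fix r :: real assume "r > 0"
  have "x \<in> closure (module.span scaleC (range u))"
    using dense by simp
  then obtain y where y: "y \<in> module.span scaleC (range u)" "dist y x < r / 2"
    using \<open>r > 0\<close> unfolding closure_approachable by (meson half_gt_zero)
  then obtain N where N: "\<forall>M\<ge>N. partial M y = y"
    using partial_fixes_span by blast
  have "dist (partial M x) x < r" if "M \<ge> N" for M
  proof -
    have eq: "partial M x - x = partial M (x - y) - (x - y)"
      using N that by (simp add: partial_diff)
    have "norm (partial M x - x) \<le> norm (x - y) + norm (x - y)"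
      unfolding eq using norm_triangle_ineq4 [of "partial M (x - y)" "x - y"]
        norm_partial_le [of M "x - y"] by linarith
    then show ?thesis
      using y(2) by (simp add: dist_norm norm_minus_commute)
  qed
  then show "\<exists>no. \<forall>M\<ge>no. dist (partial M x) x < r" by blast
qed

text \<open>Half of Parseval's identity: norms are estimated from coefficients by letting the
  truncations converge.\<close>

lemma norm_le_coeffs:
  assumes "\<And>N. (\<Sum>n<N. (cmod (coeff x n))\<^sup>2) \<le> B\<^sup>2" "B \<ge> 0"
  shows "norm x \<le> B"
proof (rule LIMSEQ_le_const2)
  show "(\<lambda>N. norm (partial N x)) \<longlonglongrightarrow> norm x"
    by (intro tendsto_norm partial_tendsto)
  have "norm (partial N x) \<le> B" for N
    using assms by (intro power2_le_imp_le [OF _ \<open>B \<ge> 0\<close>]) (simp add: norm_partial)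
  then show "\<exists>N. \<forall>n\<ge>N. norm (partial n x) \<le> B" by blast
qed

lemma coeff_eqI:
  assumes "\<And>n. coeff x n = coeff y n"
  shows "x = y"
proof -
  have "norm (x - y) \<le> 0"
    by (rule norm_le_coeffs) (use assms in \<open>auto simp: cinner_diff_left\<close>)
  then show ?thesis by simp
qed

text \<open>The maps are only real-linear, so agreement is required on all complex multiples of the
  basis vectors. Truncations then carry it to every \<open>x\<close> by continuity.\<close>

lemma bounded_linear_eqI:
  fixes f g :: "ell2 \<Rightarrow> 'b::real_normed_vector"
  assumes "bounded_linear f" "bounded_linear g"
    and eq: "\<And>d n. f (d *\<^sub>C u n) = g (d *\<^sub>C u n)"
  shows "f x = g x"
proof (rule LIMSEQ_unique)
  show "(\<lambda>N. f (partial N x)) \<longlonglongrightarrow> f x"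
    by (intro bounded_linear.tendsto [OF assms(1)] partial_tendsto)
  have "f (partial N x) = g (partial N x)" for N
    unfolding partial_def
    by (simp add: linear_sum bounded_linear.linear assms(1,2) eq)
  then show "(\<lambda>N. f (partial N x)) \<longlonglongrightarrow> g x"
    using bounded_linear.tendsto [OF assms(2) partial_tendsto] by simp
qed

text \<open>Blocks of \<open>X\<close> have squared norm equal to blocks of the given convergent
  series, so \<open>X\<close> is Cauchy; completeness yields the vector. It is used to turn weighted
  sequences and Green columns into elements of the space.\<close>

lemma riesz_fischer:
  assumes "summable (\<lambda>n. (cmod (d n))\<^sup>2)"
  obtains x where "\<And>n. coeff x n = d n"
proof -
  define X where "X N = (\<Sum>n<N. d n *\<^sub>C u n)" for N
  have "Cauchy X"
  proof (rule metric_CauchyI)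
    fix r :: real assume "r > 0"
    then obtain N where N: "\<And>m n. m \<ge> N \<Longrightarrow> norm (\<Sum>k=m..<n. (cmod (d k))\<^sup>2) < r\<^sup>2"
      using assms unfolding summable_Cauchy by (meson zero_less_power)
    have *: "dist (X n) (X m) < r" if "N \<le> m" "m \<le> n" for m n
    proof -
      have "X n = X m + (\<Sum>k=m..<n. d k *\<^sub>C u k)"
        unfolding X_def using that(2)
        by (metis atLeast0LessThan le0 sum.atLeastLessThan_concat)
      then have "(norm (X n - X m))\<^sup>2 = (\<Sum>k=m..<n. (cmod (d k))\<^sup>2)"
        by (simp add: norm_sum_basis)
      also have "\<dots> < r\<^sup>2"
        using N [OF that(1), of n] by (simp add: sum_nonneg)
      finally show ?thesis
        using \<open>r > 0\<close> by (simp add: dist_norm power_less_imp_less_base)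
    qed
    have "dist (X n) (X m) < r" if "N \<le> m" "N \<le> n" for m n
      using * that by (metis dist_commute nle_le)
    then show "\<exists>M. \<forall>m\<ge>M. \<forall>n\<ge>M. dist (X m) (X n) < r" by blast
  qed
  then obtain x where x: "X \<longlonglongrightarrow> x"
    using Cauchy_convergent convergent_def by blast
  have "coeff x n = d n" for n
  proof (rule LIMSEQ_unique)
    show "(\<lambda>N. coeff (X N) n) \<longlonglongrightarrow> coeff x n"
      by (intro bounded_linear.tendsto [OF bounded_linear_coeff] x)
    have "coeff (X N) n = d n" if "N \<ge> Suc n" for N
      unfolding X_def using that by (subst coeff_sum_basis) auto
    then show "(\<lambda>N. coeff (X N) n) \<longlonglongrightarrow> d n"
      by (intro tendsto_eventually) (auto simp: eventually_sequentially)
  qed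
  then show ?thesis by (rule that)
qed

end

section \<open>Matrices with exponential off-diagonal decay\<close>

text \<open>Injectivity makes the exponents distinct, so the sum is part of the full geometric
  series.\<close>

lemma geometric_sum_le:
  assumes "0 < q" "q < (1::real)" "finite I" "inj_on f I"
  shows "(\<Sum>n\<in>I. q ^ f n) \<le> 1 / (1 - q)"
proof -
  have "(\<Sum>n\<in>I. q ^ f n) = (\<Sum>k\<in>f ` I. q ^ k)"
    using assms(4) by (simp add: sum.reindex)
  also have "\<dots> \<le> (\<Sum>k. q ^ k)"
    using assms by (intro sum_le_suminf) (auto intro: summable_geometric)
  finally show ?thesis
    using assms by (simp add: suminf_geometric)
qed

text \<open>On each side of the diagonal the distance to \<open>m\<close> determines
  \<open>n\<close>, so each side costs one geometric series.\<close>

lemma exponential_row_sum_le: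
  fixes q :: real and m :: nat
  assumes "0 < q" "q < 1" "finite I"
  shows "(\<Sum>n\<in>I. q ^ nat \<bar>int m - int n\<bar>) \<le> 2 / (1 - q)"
proof -
  have "(\<Sum>n\<in>I. q ^ nat \<bar>int m - int n\<bar>)
      = (\<Sum>n\<in>I \<inter> {..m}. q ^ nat \<bar>int m - int n\<bar>) + (\<Sum>n\<in>I - {..m}. q ^ nat \<bar>int m - int n\<bar>)"
    by (rule sum.Int_Diff [OF assms(3)])
  also have "\<dots> \<le> 1 / (1 - q) + 1 / (1 - q)"
    using assms by (intro add_mono geometric_sum_le) (auto intro!: inj_onI)
  finally show ?thesis by simp
qed

text \<open>Schur's test: Cauchy-Schwarz for the weights \<open>q\<^bsup>\<bar>m - n\<bar>\<^esup>\<close>, whose row and column sums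
  are at most \<open>2 / (1 - q)\<close>.\<close>

lemma schur_test:
  fixes g :: "nat \<Rightarrow> nat \<Rightarrow> complex"
  assumes q: "0 < q" "q < 1" and "C \<ge> 0" and I: "finite I" and J: "finite J"
    and g: "\<And>m n. cmod (g m n) \<le> C * q ^ nat \<bar>int m - int n\<bar>"
  shows "(\<Sum>m\<in>J. (cmod (\<Sum>n\<in>I. d n * g m n))\<^sup>2)
    \<le> (C * (2 / (1 - q)))\<^sup>2 * (\<Sum>n\<in>I. (cmod (d n))\<^sup>2)"
proof -
  define w where "w m n = q ^ nat \<bar>int m - int n\<bar>" for m n :: nat
  define S where "S = 2 / (1 - q)"
  have w_pos: "w m n > 0" for m n
    using q by (simp add: w_def)
  have w_sum: "(\<Sum>n\<in>I. w m n) \<le> S" for m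
    unfolding w_def S_def by (rule exponential_row_sum_le [OF q I])
  have w_sum': "(\<Sum>m\<in>J. w m n) \<le> S" for n
  proof -
    have "(\<Sum>m\<in>J. w m n) = (\<Sum>m\<in>J. w n m)"
      by (simp add: w_def abs_minus_commute)
    then show ?thesis
      unfolding w_def S_def using exponential_row_sum_le [OF q J] by simp
  qed
  have S: "S \<ge> 0" using q by (simp add: S_def)
  have row: "(cmod (\<Sum>n\<in>I. d n * g m n))\<^sup>2 \<le> C\<^sup>2 * S * (\<Sum>n\<in>I. w m n * (cmod (d n))\<^sup>2)" for m
  proof -
    have "cmod (\<Sum>n\<in>I. d n * g m n) \<le> (\<Sum>n\<in>I. cmod (d n) * (C * w m n))"
      by (rule sum_norm_le) (auto simp: norm_mult w_def intro!: mult_left_mono g)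
    \<comment> \<open>One square root of the weight is kept apart and the other stays with
      \<open>d n\<close>: after Cauchy-Schwarz the first gives a row sum, the second a weighted
      square sum that is later summed over \<open>m\<close>.\<close>
    also have "\<dots> = C * (\<Sum>n\<in>I. sqrt (w m n) * (sqrt (w m n) * cmod (d n)))"
      unfolding sum_distrib_left
    proof (rule sum.cong)
      fix n
      have "sqrt (w m n) * sqrt (w m n) = w m n"
        using w_pos [of m n] by simp
      then show "cmod (d n) * (C * w m n) = C * (sqrt (w m n) * (sqrt (w m n) * cmod (d n)))"
        by (metis mult.assoc mult.commute)
    qed simp
    finally have "(cmod (\<Sum>n\<in>I. d n * g m n))\<^sup>2
        \<le> (C * (\<Sum>n\<in>I. sqrt (w m n) * (sqrt (w m n) * cmod (d n))))\<^sup>2"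
      by (rule power_mono) simp
    also have "\<dots> \<le> C\<^sup>2 * ((\<Sum>n\<in>I. (sqrt (w m n))\<^sup>2) * (\<Sum>n\<in>I. (sqrt (w m n) * cmod (d n))\<^sup>2))"
      unfolding power_mult_distrib [of C] by (intro mult_left_mono Cauchy_Schwarz_ineq_sum) simp
    also have "\<dots> = C\<^sup>2 * ((\<Sum>n\<in>I. w m n) * (\<Sum>n\<in>I. w m n * (cmod (d n))\<^sup>2))"
      using w_pos by (simp add: power_mult_distrib less_imp_le)
    also have "\<dots> \<le> C\<^sup>2 * (S * (\<Sum>n\<in>I. w m n * (cmod (d n))\<^sup>2))"
      using w_pos by (intro mult_left_mono mult_right_mono w_sum sum_nonneg) (auto simp: less_imp_le)
    finally show ?thesis by (simp add: mult.assoc)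
  qed
  have "(\<Sum>m\<in>J. (cmod (\<Sum>n\<in>I. d n * g m n))\<^sup>2)
      \<le> (\<Sum>m\<in>J. C\<^sup>2 * S * (\<Sum>n\<in>I. w m n * (cmod (d n))\<^sup>2))"
    by (rule sum_mono) (rule row)
  also have "\<dots> = C\<^sup>2 * S * (\<Sum>n\<in>I. (\<Sum>m\<in>J. w m n) * (cmod (d n))\<^sup>2)"
    by (simp add: sum_distrib_left sum_distrib_right) (rule sum.swap)
  also have "\<dots> \<le> C\<^sup>2 * S * (\<Sum>n\<in>I. S * (cmod (d n))\<^sup>2)"
    using S by (intro mult_left_mono sum_mono mult_right_mono w_sum') auto
  also have "\<dots> = (C * S)\<^sup>2 * (\<Sum>n\<in>I. (cmod (d n))\<^sup>2)"
    by (simp add: sum_distrib_left power2_eq_square mult.assoc mult.left_commute)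
  finally show ?thesis
    unfolding S_def .
qed

text \<open>Preimages chosen with a norm bound form a bounded right inverse; injectivity forces the
  choice, which makes it complex linear and also a left inverse.\<close>

lemma bounded_clinear_inverse:
  assumes T: "bounded_clinear T"
    and inj: "\<And>x. T x = 0 \<Longrightarrow> x = 0"
    and onto: "\<And>x. \<exists>y. T y = x \<and> norm y \<le> K * norm x"
  shows "\<exists>R. bounded_clinear R \<and> (\<forall>x. R (T x) = x) \<and> (\<forall>x. T (R x) = x)"
proof -
  obtain R where TR: "\<And>x. T (R x) = x" and R: "\<And>x. norm (R x) \<le> K * norm x"
    using onto by metis
  have lin: "linear T"
    using T by (simp add: bounded_clinear_def bounded_linear.linear)
  have uniq: "x = y" if "T x = T y" for x y
    using inj [of "x - y"] that by (simp add: linear_diff [OF lin])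
  have Tc: "T (c *\<^sub>C x) = c *\<^sub>C T x" for c x
    using T by (simp add: bounded_clinear_def)
  have add: "R (x + y) = R x + R y" for x y
    by (rule uniq) (simp add: TR linear_add [OF lin])
  have scale: "R (c *\<^sub>C x) = c *\<^sub>C R x" for c x
    by (rule uniq) (simp add: TR Tc)
  have "bounded_clinear R"
    unfolding bounded_clinear_def
    by (auto simp: scale scaleR_scaleC add R mult.commute intro!: bounded_linear_intro [where K = K])
  then show ?thesis
    using TR uniq by blast
qed

context orthonormal_basis
begin

text \<open>The preimage of \<open>x\<close> is minus the series of the \<open>F n\<close> weighted
  by the coefficients of \<open>x\<close>. Schur's test controls its finite sums by those of the
  expansion of \<open>x\<close>, hence it converges.\<close>

lemma surjective_of_decaying_columns:
  assumes T: "bounded_clinear T" and TF: "\<And>n. T (F n) = - u n"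
    and q: "0 < q" "q < 1" and "C \<ge> 0"
    and F: "\<And>m n. cmod (coeff (F n) m) \<le> C * q ^ nat \<bar>int m - int n\<bar>"
  shows "\<exists>y. T y = x \<and> norm y \<le> C * (2 / (1 - q)) * norm x"
proof -
  define K where "K = C * (2 / (1 - q))"
  have K: "K \<ge> 0" using q \<open>C \<ge> 0\<close> by (simp add: K_def)
  have lin: "linear T"
    using T by (simp add: bounded_clinear_def bounded_linear.linear)
  \<comment> \<open>Arbitrary finite index sets are allowed so that one estimate serves both initial
    segments and the blocks \<open>{m..<n}\<close> in the Cauchy argument.\<close>
  define Y where "Y I = - (\<Sum>n\<in>I. coeff x n *\<^sub>C F n)" for I
  define X where "X I = (\<Sum>n\<in>I. coeff x n *\<^sub>C u n)" for I
  have TY: "T (Y I) = X I" for I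
  proof -
    have "T (coeff x n *\<^sub>C F n) = - (coeff x n *\<^sub>C u n)" for n
      using T TF by (simp add: bounded_clinear_def)
    then show ?thesis
      by (simp add: X_def Y_def linear_neg [OF lin] linear_sum [OF lin] sum_negf)
  qed
  have Y_le: "norm (Y I) \<le> K * norm (X I)" if "finite I" for I
  proof (rule norm_le_coeffs)
    fix N
    have c: "cmod (coeff (Y I) m) = cmod (\<Sum>n\<in>I. coeff x n * coeff (F n) m)" for m
      using cinner_diff_left [of 0 "- Y I" "u m"]
      by (simp add: Y_def cinner_sum_left cinner_scaleC_left)
    have "(\<Sum>m<N. (cmod (coeff (Y I) m))\<^sup>2) \<le> K\<^sup>2 * (\<Sum>n\<in>I. (cmod (coeff x n))\<^sup>2)"
      unfolding c K_def by (rule schur_test [OF q \<open>C \<ge> 0\<close> that]) (auto intro: F)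
    also have "\<dots> = (K * norm (X I))\<^sup>2"
      by (simp add: X_def norm_sum_basis [OF that] power_mult_distrib)
    finally show "(\<Sum>m<N. (cmod (coeff (Y I) m))\<^sup>2) \<le> (K * norm (X I))\<^sup>2" .
  qed (use K in simp)
  have X_partial: "X {..<N} = partial N x" for N
    by (simp add: X_def partial_def)
  have X_lim: "(\<lambda>N. X {..<N}) \<longlonglongrightarrow> x"
    unfolding X_partial by (rule partial_tendsto)
  have "Cauchy (\<lambda>N. Y {..<N})"
  proof (rule metric_CauchyI)
    fix r :: real assume "r > 0"
    \<comment> \<open>Dividing by \<open>K + 1\<close> keeps the tolerance meaningful when
      \<open>K = 0\<close>.\<close>
    then have "r / (K + 1) > 0" using K by simp
    then obtain N where N: "\<And>m n. m \<ge> N \<Longrightarrow> n \<ge> N \<Longrightarrow> dist (X {..<m}) (X {..<n}) < r / (K + 1)"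
      using LIMSEQ_imp_Cauchy [OF X_lim] by (meson metric_CauchyD)
    have *: "dist (Y {..<n}) (Y {..<m}) < r" if "N \<le> m" "m \<le> n" for m n
    proof -
      have split: "(\<Sum>k<n. f k) = (\<Sum>k<m. f k) + (\<Sum>k=m..<n. f k)" for f :: "nat \<Rightarrow> ell2"
        using that(2) by (metis atLeast0LessThan le0 sum.atLeastLessThan_concat)
      have "dist (Y {..<n}) (Y {..<m}) = norm (Y {m..<n})"
        unfolding dist_norm by (simp add: Y_def split [of "\<lambda>n. coeff x n *\<^sub>C F n"])
      also have "\<dots> \<le> K * norm (X {m..<n})"
        by (rule Y_le) simp
      also have "norm (X {m..<n}) = dist (X {..<n}) (X {..<m})"
        unfolding dist_norm by (simp add: X_def split [of "\<lambda>n. coeff x n *\<^sub>C u n"])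
      also have "K * dist (X {..<n}) (X {..<m}) \<le> K * (r / (K + 1))"
        using K N [of n m] that by (intro mult_left_mono) auto
      also have "\<dots> < r"
        using K \<open>r > 0\<close> by (simp add: field_simps)
      finally show ?thesis .
    qed
    have "dist (Y {..<m}) (Y {..<n}) < r" if "N \<le> m" "N \<le> n" for m n
      using * that by (metis dist_commute nle_le)
    then show "\<exists>M. \<forall>m\<ge>M. \<forall>n\<ge>M. dist (Y {..<m}) (Y {..<n}) < r" by blast
  qed
  then obtain y where y: "(\<lambda>N. Y {..<N}) \<longlonglongrightarrow> y"
    using Cauchy_convergent convergent_def by blast
  have "(\<lambda>N. T (Y {..<N})) \<longlonglongrightarrow> T y"
    by (intro bounded_linear.tendsto [OF bounded_clinear_linear [OF T]] y)
  then have "T y = x"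
    unfolding TY using X_lim LIMSEQ_unique by blast
  moreover have "norm y \<le> K * norm x"
  proof (rule LIMSEQ_le_const2)
    show "(\<lambda>N. norm (Y {..<N})) \<longlonglongrightarrow> norm y"
      by (intro tendsto_norm y)
    have "norm (Y {..<N}) \<le> K * norm x" for N
      using Y_le [of "{..<N}"] norm_partial_le [of N x] K
      by (metis X_partial finite_lessThan mult_left_mono order_trans)
    then show "\<exists>N. \<forall>n\<ge>N. norm (Y {..<n}) \<le> K * norm x" by blast
  qed
  ultimately show ?thesis
    unfolding K_def by blast
qed

end

section \<open>Tridiagonal operators\<close>

text \<open>Both off-diagonals carry the smaller of their two indices: \<open>\<alpha> n\<close>
  sits in row \<open>n\<close>, column \<open>n + 1\<close>, and \<open>\<rho> n\<close> in row
  \<open>n + 1\<close>, column \<open>n\<close>. The diagonal of \<open>T\<close> is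
  \<open>\<beta>\<close>.\<close>

locale tridiagonal_operator = orthonormal_basis u for u +
  fixes T :: "ell2 \<Rightarrow> ell2" and \<alpha> \<beta> \<rho> :: "nat \<Rightarrow> complex"
  assumes T: "bounded_clinear T"
    and T_u_0: "T (u 0) = \<beta> 0 *\<^sub>C u 0 + \<rho> 0 *\<^sub>C u 1"
    and T_u_Suc: "T (u (Suc n)) =
      \<alpha> n *\<^sub>C u n + \<beta> (Suc n) *\<^sub>C u (Suc n) + \<rho> (Suc n) *\<^sub>C u (Suc (Suc n))"
begin

lemma coeff_T_scaleC: "coeff (T (d *\<^sub>C x)) m = d * coeff (T x) m"
  using T by (simp add: bounded_clinear_def cinner_scaleC_left)

lemma bounded_linear_coeff_T: "bounded_linear (\<lambda>x. coeff (T x) m)"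
  by (rule bounded_linear_compose [OF bounded_linear_coeff bounded_clinear_linear [OF T]])

text \<open>The assumptions describe columns, while this and the next lemma read off rows: both
  sides are bounded and linear in \<open>x\<close> and agree on multiples of the basis
  vectors.\<close>

lemma coeff_T_0: "coeff (T x) 0 = \<beta> 0 * coeff x 0 + \<alpha> 0 * coeff x 1"
proof (rule bounded_linear_eqI [OF bounded_linear_coeff_T])
  show "bounded_linear (\<lambda>x. \<beta> 0 * coeff x 0 + \<alpha> 0 * coeff x 1)"
    by (intro bounded_linear_add bounded_linear_const_mult bounded_linear_coeff)
  show "coeff (T (d *\<^sub>C u n)) 0 = \<beta> 0 * coeff (d *\<^sub>C u n) 0 + \<alpha> 0 * coeff (d *\<^sub>C u n) 1" for d n
    by (cases n) (simp_all add: coeff_T_scaleC T_u_0 T_u_Suc cinner_add_left cinner_scaleC_left cinner_u)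
qed

lemma coeff_T_Suc:
  "coeff (T x) (Suc m) =
    \<rho> m * coeff x m + \<beta> (Suc m) * coeff x (Suc m) + \<alpha> (Suc m) * coeff x (Suc (Suc m))"
proof (rule bounded_linear_eqI [OF bounded_linear_coeff_T])
  show "bounded_linear (\<lambda>x. \<rho> m * coeff x m + \<beta> (Suc m) * coeff x (Suc m)
      + \<alpha> (Suc m) * coeff x (Suc (Suc m)))"
    by (intro bounded_linear_add bounded_linear_const_mult bounded_linear_coeff)
  show "coeff (T (d *\<^sub>C u n)) (Suc m) = \<rho> m * coeff (d *\<^sub>C u n) m
      + \<beta> (Suc m) * coeff (d *\<^sub>C u n) (Suc m) + \<alpha> (Suc m) * coeff (d *\<^sub>C u n) (Suc (Suc m))"
    for d n
    by (cases n) (auto simp: coeff_T_scaleC T_u_0 T_u_Suc cinner_add_left cinner_scaleC_left cinner_u)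
qed

text \<open>Every matrix entry is a coefficient of some \<open>T (u n)\<close>, hence at most the
  bound of \<open>T\<close>.\<close>

lemma entries_bounded:
  obtains L where "L > 0" "\<And>n. cmod (\<alpha> n) \<le> L" "\<And>n. cmod (\<rho> n) \<le> L"
proof -
  obtain L where L: "L > 0" "\<And>x. norm (T x) \<le> norm x * L"
    using bounded_linear.pos_bounded [OF bounded_clinear_linear [OF T]] by blast
  have *: "cmod (coeff (T (u n)) m) \<le> L" for m n
    using cmod_coeff_le [of "T (u n)" m] L(2) [of "u n"] by (simp add: norm_u)
  have "cmod (\<alpha> n) \<le> L" for n
    using * [of "Suc n" n] by (simp add: T_u_Suc cinner_add_left cinner_scaleC_left cinner_u)
  moreover have "cmod (\<rho> n) \<le> L" for n
    using * [of n "Suc n"]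
    by (cases n) (simp_all add: T_u_0 T_u_Suc cinner_add_left cinner_scaleC_left cinner_u)
  ultimately show ?thesis
    using that L(1) by blast
qed

text \<open>The Combes-Thomas argument: a slowly varying weight nearly commutes with a tridiagonal
  operator, so the lower bound for \<open>T\<close> survives multiplication of the coefficients by it.\<close>

lemma weighted_coeff_le:
  fixes w :: "nat \<Rightarrow> real"
  assumes lower: "\<And>x. norm x \<le> K * norm (T x)" and "K \<ge> 0"
    and \<alpha>: "\<And>n. cmod (\<alpha> n) \<le> L" and \<rho>: "\<And>n. cmod (\<rho> n) \<le> L"
    and \<epsilon>: "\<epsilon> \<ge> 0" "4 * K * L * \<epsilon> \<le> 1"
    and w: "\<And>m. 0 \<le> w m" "\<And>m. w m \<le> B"
    and slow: "\<And>m. \<bar>w (Suc m) - w m\<bar> \<le> \<epsilon> * w m" "\<And>m. \<bar>w (Suc m) - w m\<bar> \<le> \<epsilon> * w (Suc m)"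
    and x: "T x = u n"
  shows "w m * cmod (coeff x m) \<le> 2 * K * w n"
proof -
  have "L \<ge> 0"
    using \<alpha> [of 0] norm_ge_zero [of "\<alpha> 0"] by linarith
  \<comment> \<open>The bound \<open>B\<close> enters only here, to make the weighted sequence a
    vector; the final estimate is therefore uniform in \<open>B\<close>.\<close>
  have summable_y: "summable (\<lambda>m. (cmod (of_real (w m) * coeff x m))\<^sup>2)"
  proof (rule summable_comparison_test')
    show "summable (\<lambda>m. B\<^sup>2 * (cmod (coeff x m))\<^sup>2)"
      by (intro summable_mult summable_coeff)
    show "norm ((cmod (of_real (w m) * coeff x m))\<^sup>2) \<le> B\<^sup>2 * (cmod (coeff x m))\<^sup>2" if "m \<ge> 0" for m
      using w by (simp add: norm_mult power_mult_distrib mult_right_mono power_mono)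
  qed
  obtain y where y: "\<And>m. coeff y m = of_real (w m) * coeff x m"
    using riesz_fischer [OF summable_y] by blast
  \<comment> \<open>Since \<open>T x = u n\<close>, the subtracted term is the weighted
    \<open>T x\<close>. Thus \<open>v\<close> is the commutator of \<open>T\<close> with the weight,
    applied to \<open>x\<close>; the diagonal of \<open>T\<close> drops out of it.\<close>
  define v where "v = T y - of_real (w n) *\<^sub>C u n"
  have v: "coeff v m = coeff (T y) m - of_real (w m) * coeff (T x) m" for m
    unfolding v_def cinner_diff_left cinner_scaleC_left x cinner_u by auto
  \<comment> \<open>An entry of the commutator contains the increment of \<open>w\<close> between
    neighbours; comparing it with \<open>w i\<close> turns \<open>coeff x i\<close> into
    \<open>coeff y i\<close>.\<close>
  have shift: "cmod (t * (of_real (w i - w j) * coeff x i)) \<le> L * \<epsilon> * cmod (coeff y i)"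
    if "cmod t \<le> L" "\<bar>w i - w j\<bar> \<le> \<epsilon> * w i" for t i j
  proof -
    have "cmod (t * (of_real (w i - w j) * coeff x i)) = cmod t * (\<bar>w i - w j\<bar> * cmod (coeff x i))"
      by (simp add: norm_mult del: of_real_diff)
    also have "\<dots> \<le> L * (\<epsilon> * w i * cmod (coeff x i))"
      using that \<open>L \<ge> 0\<close> by (intro mult_mono) (auto intro: mult_right_mono)
    finally show ?thesis
      using w(1) by (simp add: y norm_mult mult.assoc)
  qed
  \<comment> \<open>Row \<open>0\<close> has a single neighbour. The spare factor \<open>2\<close>
    gives its bound the same form as in the other rows.\<close>
  have v_0: "(cmod (coeff v 0))\<^sup>2 \<le> (L * \<epsilon>)\<^sup>2 * (2 * (cmod (coeff y 1))\<^sup>2)"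
  proof -
    have "coeff v 0 = \<alpha> 0 * (of_real (w 1 - w 0) * coeff x 1)"
      by (simp add: v coeff_T_0 y algebra_simps)
    then have "cmod (coeff v 0) \<le> L * \<epsilon> * cmod (coeff y 1)"
      using shift [OF \<alpha>, of 1 0 0] slow(2) [of 0] by simp
    then have "(cmod (coeff v 0))\<^sup>2 \<le> (L * \<epsilon>)\<^sup>2 * (cmod (coeff y 1))\<^sup>2"
      unfolding power_mult_distrib [symmetric] by (rule power_mono) simp
    also have "\<dots> \<le> (L * \<epsilon>)\<^sup>2 * (2 * (cmod (coeff y 1))\<^sup>2)"
      by (intro mult_left_mono) auto
    finally show ?thesis .
  qed
  have v_Suc: "(cmod (coeff v (Suc m)))\<^sup>2
      \<le> (L * \<epsilon>)\<^sup>2 * (2 * (cmod (coeff y m))\<^sup>2 + 2 * (cmod (coeff y (Suc (Suc m))))\<^sup>2)" for m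
  proof -
    have eq: "coeff v (Suc m) = \<rho> m * (of_real (w m - w (Suc m)) * coeff x m)
        + \<alpha> (Suc m) * (of_real (w (Suc (Suc m)) - w (Suc m)) * coeff x (Suc (Suc m)))"
      by (simp add: v coeff_T_Suc y algebra_simps)
    have sq: "(cmod (\<rho> m * (of_real (w m - w (Suc m)) * coeff x m)))\<^sup>2 \<le> (L * \<epsilon> * cmod (coeff y m))\<^sup>2"
      "(cmod (\<alpha> (Suc m) * (of_real (w (Suc (Suc m)) - w (Suc m)) * coeff x (Suc (Suc m)))))\<^sup>2
        \<le> (L * \<epsilon> * cmod (coeff y (Suc (Suc m))))\<^sup>2"
      using slow(1) [of m]
      by (intro power_mono shift \<alpha> \<rho> slow; simp add: abs_minus_commute)+
    show ?thesis
      unfolding eq using sq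
      by (intro order_trans [OF cmod_add_square_le]) (simp add: power_mult_distrib algebra_simps)
  qed
  have "norm v \<le> 2 * L * \<epsilon> * norm y"
  proof (rule norm_le_coeffs)
    fix N
    define f where "f m = (cmod (coeff y m))\<^sup>2" for m
    have f: "0 \<le> f m" "(\<Sum>m<M. f m) \<le> (norm y)\<^sup>2" for m M
      using sum_coeff_le by (simp_all add: f_def)
    \<comment> \<open>The upper neighbours of rows \<open>0\<close> to \<open>N\<close> have the
      indices \<open>1\<close> to \<open>N + 1\<close>, each once, so they too are controlled by the
      norm of \<open>y\<close>.\<close>
    have "f 1 + (\<Sum>m<N. f (Suc (Suc m))) \<le> (\<Sum>m<Suc (Suc N). f m)"
      using f(1) [of 0] by (simp add: sum.lessThan_Suc_shift del: sum.lessThan_Suc)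
    then have tail: "f 1 + (\<Sum>m<N. f (Suc (Suc m))) \<le> (norm y)\<^sup>2"
      using f(2) by (rule order_trans)
    have "(\<Sum>m<N. (cmod (coeff v m))\<^sup>2) \<le> (\<Sum>m<Suc N. (cmod (coeff v m))\<^sup>2)"
      by simp
    also have "\<dots> = (cmod (coeff v 0))\<^sup>2 + (\<Sum>m<N. (cmod (coeff v (Suc m)))\<^sup>2)"
      by (rule sum.lessThan_Suc_shift)
    also have "\<dots> \<le> (L * \<epsilon>)\<^sup>2 * (2 * f 1) + (\<Sum>m<N. (L * \<epsilon>)\<^sup>2 * (2 * f m + 2 * f (Suc (Suc m))))"
      unfolding f_def by (intro add_mono sum_mono v_0 v_Suc)
    also have "\<dots> = (L * \<epsilon>)\<^sup>2 * (2 * (\<Sum>m<N. f m) + 2 * (f 1 + (\<Sum>m<N. f (Suc (Suc m)))))"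
      by (simp add: sum_distrib_left sum.distrib algebra_simps)
    also have "\<dots> \<le> (L * \<epsilon>)\<^sup>2 * (2 * (norm y)\<^sup>2 + 2 * (norm y)\<^sup>2)"
      by (intro mult_left_mono add_mono f(2) tail) auto
    also have "\<dots> = (2 * L * \<epsilon> * norm y)\<^sup>2"
      by (simp add: power_mult_distrib)
    finally show "(\<Sum>m<N. (cmod (coeff v m))\<^sup>2) \<le> (2 * L * \<epsilon> * norm y)\<^sup>2" .
  qed (use \<open>L \<ge> 0\<close> \<epsilon>(1) in simp)
  moreover have "norm (T y) \<le> norm v + w n"
    using norm_triangle_ineq [of v "of_real (w n) *\<^sub>C u n"] w(1) by (simp add: v_def norm_scaleC norm_u)
  ultimately have "norm y \<le> K * (2 * L * \<epsilon> * norm y + w n)"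
    using \<open>K \<ge> 0\<close> by (intro order_trans [OF lower mult_left_mono]) simp_all
  also have "\<dots> = (4 * K * L * \<epsilon>) * (norm y / 2) + K * w n"
    by (simp add: algebra_simps)
  \<comment> \<open>The choice of \<open>\<epsilon>\<close> leaves at most half of
    \<open>norm y\<close> on the right, to be absorbed on the left.\<close>
  also have "\<dots> \<le> 1 * (norm y / 2) + K * w n"
    using \<epsilon>(2) by (intro add_right_mono mult_right_mono) simp_all
  finally have "norm y \<le> 2 * K * w n"
    by simp
  then show ?thesis
    using cmod_coeff_le [of y m] w(1) by (simp add: y norm_mult)
qed

text \<open>The weighted estimate is applied with weights of ratio \<open>1 + \<epsilon>\<close>
  between neighbours, made constant beyond a cut-off that depends on the entry. The constants depend
  on \<open>K\<close> and the entry bound \<open>L\<close> only.\<close>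

lemma exponential_decay:
  assumes lower: "\<And>x. norm x \<le> K * norm (T x)" and "K > 0"
  obtains C q where "C > 0" "0 < q" "q < 1"
    "\<And>x m n. T x = u n \<Longrightarrow> cmod (coeff x m) \<le> C * q ^ nat \<bar>int m - int n\<bar>"
proof -
  obtain L where L: "L > 0" "\<And>n. cmod (\<alpha> n) \<le> L" "\<And>n. cmod (\<rho> n) \<le> L"
    using entries_bounded by blast
  \<comment> \<open>The largest value that the absorption in \<open>weighted_coeff_le\<close>
    permits.\<close>
  define \<epsilon> where "\<epsilon> = 1 / (4 * K * L)"
  have \<epsilon>: "\<epsilon> > 0" "4 * K * L * \<epsilon> \<le> 1"
    using \<open>K > 0\<close> L(1) by (simp_all add: \<epsilon>_def)
  define q where "q = 1 / (1 + \<epsilon>)"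
  have q: "0 < q" "q < 1" "(1 + \<epsilon>) * q = 1"
    using \<epsilon>(1) by (simp_all add: q_def)
  note bound = weighted_coeff_le [OF lower less_imp_le [OF \<open>K > 0\<close>] L(2,3) less_imp_le [OF \<epsilon>(1)] \<epsilon>(2)]
  have "cmod (coeff x m) \<le> 2 * K * q ^ nat \<bar>int m - int n\<bar>" if x: "T x = u n" for x m n
  proof (cases "n \<le> m")
    case True
    \<comment> \<open>A growing weight, capped at \<open>m\<close> to stay bounded. The estimate
      gains the factor \<open>w n / w m\<close>, which is \<open>q ^ (m - n)\<close>.\<close>
    define w where "w k = (1 + \<epsilon>) ^ min k m" for k
    have slow: "\<bar>w (Suc k) - w k\<bar> \<le> \<epsilon> * w k" "w k \<le> w (Suc k)" for k
      using \<epsilon>(1) by (cases "k < m"; simp add: w_def min_def algebra_simps)+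
    have "w m * cmod (coeff x m) \<le> 2 * K * w n"
    proof (rule bound [where w = w and x = x and n = n, OF _ _ slow(1) _ x])
      show "0 \<le> w k" "w k \<le> (1 + \<epsilon>) ^ m" for k
        using \<epsilon>(1) by (auto simp: w_def intro: power_increasing)
      show "\<bar>w (Suc k) - w k\<bar> \<le> \<epsilon> * w (Suc k)" for k
        using slow [of k] \<epsilon>(1) mult_left_mono [OF slow(2) [of k], of \<epsilon>] by linarith
    qed
    then have "q ^ m * ((1 + \<epsilon>) ^ m * cmod (coeff x m)) \<le> q ^ m * (2 * K * (1 + \<epsilon>) ^ n)"
      using True q by (intro mult_left_mono) (auto simp: w_def min_def)
    moreover have "q ^ m * (1 + \<epsilon>) ^ m = 1"
      using q(3) by (metis mult.commute power_mult_distrib power_one)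
    moreover have "q ^ m * (1 + \<epsilon>) ^ n = q ^ (m - n)"
    proof -
      have "q ^ m = q ^ (m - n) * q ^ n"
        using True by (simp flip: power_add)
      moreover have "q ^ n * (1 + \<epsilon>) ^ n = 1"
        using q(3) by (metis mult.commute power_mult_distrib power_one)
      ultimately show ?thesis by simp
    qed
    moreover have "nat \<bar>int m - int n\<bar> = m - n"
      using True by simp
    ultimately show ?thesis
      by (metis mult.assoc mult.left_commute mult_1)
  next
    case False
    \<comment> \<open>Above the diagonal the weight decreases up to \<open>n\<close>, and
      \<open>w n / w m\<close> is \<open>q ^ (n - m)\<close>.\<close>
    define w where "w k = q ^ min k n" for k
    have slow: "\<bar>w (Suc k) - w k\<bar> \<le> \<epsilon> * w (Suc k)" "w (Suc k) \<le> w k" for k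
    proof -
      have "w k - w (Suc k) = \<epsilon> * w (Suc k)" if "k < n"
      proof -
        have "w k = (1 + \<epsilon>) * q * w k" using q(3) by simp
        also have "\<dots> = (1 + \<epsilon>) * w (Suc k)"
          using that by (simp add: w_def min_def)
        finally show ?thesis by (simp add: algebra_simps)
      qed
      moreover have "w k = w (Suc k)" if "\<not> k < n"
        using that by (simp add: w_def min_def)
      moreover have "\<epsilon> * w (Suc k) \<ge> 0"
        using \<epsilon>(1) q(1) by (simp add: w_def)
      ultimately show "\<bar>w (Suc k) - w k\<bar> \<le> \<epsilon> * w (Suc k)" "w (Suc k) \<le> w k"
        by (cases "k < n"; simp)+
    qed
    have "w m * cmod (coeff x m) \<le> 2 * K * w n"
    proof (rule bound [where w = w and x = x and n = n, OF _ _ _ slow(1) x])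
      show "0 \<le> w k" "w k \<le> 1" for k
        using q by (auto simp: w_def intro: power_le_one)
      show "\<bar>w (Suc k) - w k\<bar> \<le> \<epsilon> * w k" for k
        using slow [of k] \<epsilon>(1) mult_left_mono [OF slow(2) [of k], of \<epsilon>] by linarith
    qed
    moreover have "q ^ n = q ^ m * q ^ (n - m)" "nat \<bar>int m - int n\<bar> = n - m"
      using False by (simp_all flip: power_add)
    ultimately have "q ^ m * cmod (coeff x m) \<le> q ^ m * (2 * K * q ^ nat \<bar>int m - int n\<bar>)"
      using False by (simp add: w_def min_def mult.left_commute mult.assoc)
    then show ?thesis
      using q(1) by (simp add: mult_le_cancel_left_pos)
  qed
  then show ?thesis
    using that [of "2 * K" q] \<open>K > 0\<close> q by simp
qed

end

section \<open>The Green matrix\<close>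

text \<open>The summand \<open>- 1\<close> is the defect of the remainder in row \<open>0\<close>,
  where the denominators satisfy the homogeneous equation. It produces the source term of the Green
  matrix in the corner.\<close>

lemma remainder_0: "remainder a b \<gamma> z 0 = \<gamma>"
  and remainder_1: "remainder a b \<gamma> z (Suc 0) = (z - b 0) * \<gamma> - 1"
  by (simp_all add: remainder_def)

lemma denom_Suc_Suc:
  "poly (denom_poly a b (Suc (Suc n))) z =
    (z - b (Suc n)) * poly (denom_poly a b (Suc n)) z - a (Suc n) * poly (denom_poly a b n) z"
  by (simp add: algebra_simps)

lemma remainder_Suc_Suc:
  "remainder a b \<gamma> z (Suc (Suc n)) =
    (z - b (Suc n)) * remainder a b \<gamma> z (Suc n) - a (Suc n) * remainder a b \<gamma> z n"
  by (simp add: remainder_def algebra_simps)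

text \<open>Both sequences solve the same recurrence, so each step multiplies this determinant by
  the next \<open>a\<close>; it starts at \<open>1\<close>.\<close>

lemma wronskian:
  "poly (denom_poly a b (Suc m)) z * remainder a b \<gamma> z m
    - poly (denom_poly a b m) z * remainder a b \<gamma> z (Suc m) = (\<Prod>i=1..m. a i)"
proof (induction m)
  case 0
  then show ?case by (simp add: remainder_0 remainder_1 algebra_simps)
next
  case (Suc m)
  have "poly (denom_poly a b (Suc (Suc m))) z * remainder a b \<gamma> z (Suc m)
      - poly (denom_poly a b (Suc m)) z * remainder a b \<gamma> z (Suc (Suc m))
    = a (Suc m) * (poly (denom_poly a b (Suc m)) z * remainder a b \<gamma> z m
      - poly (denom_poly a b m) z * remainder a b \<gamma> z (Suc m))"
    unfolding denom_Suc_Suc remainder_Suc_Suc by (simp add: algebra_simps)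
  then show ?case
    unfolding Suc.IH by (simp add: mult.commute)
qed

text \<open>The usual Green kernel: in each column the solution regular at row \<open>0\<close> is
  glued on the diagonal to the remainder, and the Wronskian normalizes the jump. Column
  \<open>n\<close> is meant to be mapped by \<open>A - z\<close> to minus \<open>e n\<close>, in
  coordinates for the basis \<open>e\<close>.\<close>

definition green ::
    "(nat \<Rightarrow> complex) \<Rightarrow> (nat \<Rightarrow> complex) \<Rightarrow> complex \<Rightarrow> complex \<Rightarrow> nat \<Rightarrow> nat \<Rightarrow> complex"
  where "green a b \<gamma> z m n =
    (if n \<le> m then poly (denom_poly a b n) z * remainder a b \<gamma> z m
     else poly (denom_poly a b m) z * remainder a b \<gamma> z n) / (\<Prod>i=1..n. a i)"

text \<open>The two branches coincide for \<open>m = n\<close>, so both formulas may include the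
  diagonal.\<close>

lemma green_le:
  "m \<le> n \<Longrightarrow>
    green a b \<gamma> z m n = poly (denom_poly a b m) z * remainder a b \<gamma> z n / (\<Prod>i=1..n. a i)"
  by (auto simp: green_def)

lemma green_ge:
  "n \<le> m \<Longrightarrow>
    green a b \<gamma> z m n = poly (denom_poly a b n) z * remainder a b \<gamma> z m / (\<Prod>i=1..n. a i)"
  by (simp add: green_def)

lemma green_rec_0:
  "(b 0 - z) * green a b \<gamma> z 0 n + green a b \<gamma> z 1 n = (if n = 0 then - 1 else 0)"
proof (cases n)
  case 0
  then show ?thesis by (simp add: green_def remainder_0 remainder_1 algebra_simps)
next
  case (Suc k)
  then show ?thesis by (simp add: green_le add_divide_distrib [symmetric] algebra_simps)
qed

text \<open>For \<open>n \<le> m\<close> all three terms involve the remainder, for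
  \<open>n \<ge> m + 2\<close> all three involve the denominators, and either sequence solves the
  recurrence. Only \<open>n = m + 1\<close> mixes the branches.\<close>

lemma green_rec_Suc:
  assumes nonzero: "\<And>n. a (Suc n) \<noteq> 0"
  shows "a (Suc m) * green a b \<gamma> z m n + (b (Suc m) - z) * green a b \<gamma> z (Suc m) n
    + green a b \<gamma> z (Suc (Suc m)) n = (if n = Suc m then - 1 else 0)"
proof -
  define Q where "Q = (\<lambda>k. poly (denom_poly a b k) z)"
  define r where "r = remainder a b \<gamma> z"
  define W where "W n = (\<Prod>i=1..n. a i)" for n
  have W: "W n \<noteq> 0" for n
    by (induction n) (simp_all add: W_def nonzero)
  have Q: "Q (Suc (Suc m)) = (z - b (Suc m)) * Q (Suc m) - a (Suc m) * Q m"
    unfolding Q_def by (rule denom_Suc_Suc)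
  have r: "r (Suc (Suc m)) = (z - b (Suc m)) * r (Suc m) - a (Suc m) * r m"
    unfolding r_def by (rule remainder_Suc_Suc)
  have wr: "Q (Suc (Suc m)) * r (Suc m) - Q (Suc m) * r (Suc (Suc m)) = W (Suc m)"
    unfolding Q_def r_def W_def by (rule wronskian)
  have le: "green a b \<gamma> z k n = Q k * r n / W n" if "k \<le> n" for k
    using that by (simp add: green_le Q_def r_def W_def)
  have ge: "green a b \<gamma> z k n = Q n * r k / W n" if "n \<le> k" for k
    using that by (simp add: green_ge Q_def r_def W_def)
  consider "n \<le> m" | "n = Suc m" | "Suc (Suc m) \<le> n"
    by linarith
  then show ?thesis
  proof cases
    case 1
    then show ?thesis
      using W [of n] by (simp add: ge r field_simps)
  next
    case 2
    \<comment> \<open>The first two terms combine to \<open>- Q (Suc (Suc m)) * r (Suc m)\<close>,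
      and what remains is minus the Wronskian.\<close>
    have "a (Suc m) * (Q m * r n) + (b (Suc m) - z) * (Q (Suc m) * r n) + Q n * r (Suc (Suc m))
        = - W n"
      unfolding 2 wr [symmetric] Q by (simp add: algebra_simps)
    then have "(a (Suc m) * (Q m * r n) + (b (Suc m) - z) * (Q (Suc m) * r n)
        + Q n * r (Suc (Suc m))) / W n = - 1"
      using W [of n] by simp
    then show ?thesis
      using 2 le [of m] le [of "Suc m"] ge [of "Suc (Suc m)"] by (simp add: add_divide_distrib)
  next
    case 3
    then show ?thesis
      using W [of n] by (simp add: le Q field_simps)
  qed
qed

text \<open>From row \<open>n\<close> on the column is a multiple of the weighted remainder, so it
  is square-summable and defines a vector; the row equations of the Green matrix then give its
  image.\<close>

lemma (in tridiagonal_operator) green_column: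
  assumes nonzero: "\<And>n. a (Suc n) \<noteq> 0" and h: "\<And>n. h n > 0"
    and \<alpha>: "\<And>n. \<alpha> n = of_real (h n / h (Suc n))"
    and \<beta>: "\<And>n. \<beta> n = b n - z"
    and \<rho>: "\<And>n. \<rho> n = a (Suc n) * of_real (h (Suc n) / h n)"
    and square_summable: "summable (\<lambda>m. (cmod (remainder a b \<gamma> z m))\<^sup>2 * (h m)\<^sup>2)"
  shows "\<exists>x. T x = - u n \<and> (\<forall>m. coeff x m = green a b \<gamma> z m n * of_real (h m / h n))"
proof -
  define g where "g m = green a b \<gamma> z m n" for m
  define c where "c = cmod (poly (denom_poly a b n) z / (\<Prod>i=1..n. a i)) / h n"
  have h0: "h k \<noteq> 0" for k using h [of k] by simp
  have "summable (\<lambda>m. (cmod (g m * of_real (h m / h n)))\<^sup>2)"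
  proof (rule summable_comparison_test')
    show "summable (\<lambda>m. c\<^sup>2 * ((cmod (remainder a b \<gamma> z m))\<^sup>2 * (h m)\<^sup>2))"
      by (intro summable_mult square_summable)
    show "norm ((cmod (g m * of_real (h m / h n)))\<^sup>2)
        \<le> c\<^sup>2 * ((cmod (remainder a b \<gamma> z m))\<^sup>2 * (h m)\<^sup>2)" if "m \<ge> n" for m
      using that h [of n] h [of m]
      by (simp add: g_def green_ge c_def norm_mult norm_divide power_mult_distrib power_divide)
  qed
  then obtain x where x: "\<And>m. coeff x m = g m * of_real (h m / h n)"
    using riesz_fischer [of "\<lambda>m. g m * of_real (h m / h n)"] by blast
  have u: "coeff (- u n) m = (if m = n then - 1 else 0)" for m
    using cinner_diff_left [of 0 "u n" "u m"] by (simp add: cinner_u)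
  have "T x = - u n"
  proof (rule coeff_eqI)
    fix m
    show "coeff (T x) m = coeff (- u n) m"
    proof (cases m)
      case 0
      have "coeff (T x) 0 = ((b 0 - z) * g 0 + g 1) * of_real (h 0 / h n)"
        using h0 by (simp add: coeff_T_0 x \<alpha> \<beta> field_simps)
      also have "\<dots> = coeff (- u n) 0"
        unfolding g_def green_rec_0 u using h0 by simp
      finally show ?thesis using 0 by simp
    next
      case (Suc k)
      \<comment> \<open>The ratios of \<open>h\<close> inside \<open>\<alpha>\<close> and
        \<open>\<rho>\<close> convert each neighbouring factor into \<open>h (Suc k)\<close>, which
        leaves the unnormalized recurrence.\<close>
      have "coeff (T x) (Suc k) = (a (Suc k) * g k + (b (Suc k) - z) * g (Suc k) + g (Suc (Suc k)))
          * of_real (h (Suc k) / h n)"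
        using h0 by (simp add: coeff_T_Suc x \<alpha> \<beta> \<rho> field_simps)
      also have "\<dots> = coeff (- u n) (Suc k)"
        unfolding g_def green_rec_Suc [where a = a, OF nonzero] u using h0 by simp
      finally show ?thesis using Suc by simp
    qed
  qed
  then show ?thesis
    using x unfolding g_def by blast
qed

section \<open>Passage to the normalized basis and proof of the equivalence\<close>

lemma normalized_orthonormal_basis:
  assumes "orthogonal_basis e"
  shows "orthonormal_basis (\<lambda>n. of_real (inverse (norm (e n))) *\<^sub>C e n)"
proof
  define u where "u n = of_real (inverse (norm (e n))) *\<^sub>C e n" for n
  have e0: "norm (e n) \<noteq> 0" for n
    using assms by (simp add: orthogonal_basis_def)
  show "cinner (of_real (inverse (norm (e m))) *\<^sub>C e m) (of_real (inverse (norm (e n))) *\<^sub>C e n)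
      = (if m = n then 1 else 0)" for m n
    using assms e0 [of n]
    by (auto simp: orthogonal_basis_def cinner_scaleC_left cinner_scaleC_right cinner_norm
        power2_eq_square field_simps)
  \<comment> \<open>Each \<open>e n\<close> is a multiple of \<open>u n\<close>, so the span of
    \<open>u\<close> inherits density from that of \<open>e\<close>.\<close>
  have "e n \<in> module.span scaleC (range u)" for n
  proof -
    have "e n = of_real (norm (e n)) *\<^sub>C u n"
      using e0 [of n] by (simp add: u_def flip: of_real_mult)
    then show ?thesis
      by (metis scaleC.span_base scaleC.span_scale rangeI)
  qed
  then have "module.span scaleC (range e) \<subseteq> module.span scaleC (range u)"
    by (intro scaleC.span_minimal scaleC.subspace_span) auto
  then have "closure (module.span scaleC (range e)) \<subseteq> closure (module.span scaleC (range u))"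
    by (rule closure_mono)
  then show "closure (module.span scaleC (range (\<lambda>n. of_real (inverse (norm (e n))) *\<^sub>C e n))) = UNIV"
    using assms unfolding orthogonal_basis_def u_def by auto
qed

theorem theorem1:
  fixes A :: "ell2 \<Rightarrow> ell2"
    and e :: "nat \<Rightarrow> ell2"
    and h :: "nat \<Rightarrow> real"
    and a b :: "nat \<Rightarrow> complex"
    and z \<gamma> :: complex
  assumes basis: "orthogonal_basis e"
    and norm_basis: "\<And>n. norm (e n) = h n"
    and norm_pos: "\<And>n. h n > 0"
    and nonzero: "\<And>n. n \<ge> 1 \<Longrightarrow> a n \<noteq> 0"
    and bounded: "bounded_clinear A"
    and matrix: "tridiagonal_in_basis a b e A"
    and no_eigenvalue: "\<not> eigenvalue A z"
    and square_summable: "summable (\<lambda>n. (cmod (remainder a b \<gamma> z n))\<^sup>2 * (h n)\<^sup>2)"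
  shows "z \<in> resolvent_set A \<longleftrightarrow>
    (\<exists>C q. C > 0 \<and> 0 < q \<and> q < 1 \<and>
      (\<forall>m n. n \<le> m \<longrightarrow>
        cmod (poly (denom_poly a b n) z * remainder a b \<gamma> z m / (\<Prod>i=1..n. a i)
              * complex_of_real (h m / h n)) \<le> C * q ^ (m - n)) \<and>
      (\<forall>m n. m \<le> n \<longrightarrow>
        cmod (poly (denom_poly a b m) z * remainder a b \<gamma> z n / (\<Prod>i=1..n. a i)
              * complex_of_real (h m / h n)) \<le> C * q ^ (n - m)))"
proof -
  define u where "u n = of_real (inverse (h n)) *\<^sub>C e n" for n
  define T where "T x = A x - z *\<^sub>C x" for x
  \<comment> \<open>Entries of \<open>A - z\<close> after rescaling: passing from \<open>e\<close>
    to \<open>u\<close> multiplies the entry in row \<open>m\<close>, column \<open>n\<close> by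
    \<open>h m / h n\<close>.\<close>
  define \<alpha> where "\<alpha> n = complex_of_real (h n / h (Suc n))" for n
  define \<beta> where "\<beta> n = b n - z" for n
  define \<rho> where "\<rho> n = a (Suc n) * complex_of_real (h (Suc n) / h n)" for n
  define G where "G m n = green a b \<gamma> z m n * complex_of_real (h m / h n)" for m n
  have h0: "h n \<noteq> 0" for n
    using norm_pos [of n] by simp
  have nonzero_Suc: "a (Suc n) \<noteq> 0" for n
    by (simp add: nonzero)
  have T: "bounded_clinear T"
    unfolding T_def by (rule bounded_clinear_shift [OF bounded])
  have e: "e n = of_real (h n) *\<^sub>C u n" for n
    using h0 by (simp add: u_def flip: of_real_mult)
  have Tu: "T (u n) = of_real (inverse (h n)) *\<^sub>C (A (e n) - z *\<^sub>C e n)" for n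
    using bounded by (simp add: T_def u_def bounded_clinear_def scaleC.scale_right_diff_distrib mult.commute)
  interpret orthonormal_basis u
    using normalized_orthonormal_basis [OF basis] by (simp add: u_def [abs_def] norm_basis)
  interpret tridiagonal_operator u T \<alpha> \<beta> \<rho>
  proof
    show "bounded_clinear T" by (rule T)
    have "A (e 0) = b 0 *\<^sub>C e 0 + a 1 *\<^sub>C e 1"
      using matrix by (simp add: tridiagonal_in_basis_def)
    then have "T (u 0) = of_real (inverse (h 0)) *\<^sub>C (b 0 *\<^sub>C e 0 + a 1 *\<^sub>C e 1 - z *\<^sub>C e 0)"
      by (simp add: Tu)
    then show "T (u 0) = \<beta> 0 *\<^sub>C u 0 + \<rho> 0 *\<^sub>C u 1"
      using h0 [of 0]
      by (simp add: e \<beta>_def \<rho>_def scaleC.scale_right_diff_distrib scaleC.scale_right_distrib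
          scaleC.scale_left_diff_distrib field_simps)
    show "T (u (Suc n)) = \<alpha> n *\<^sub>C u n + \<beta> (Suc n) *\<^sub>C u (Suc n) + \<rho> (Suc n) *\<^sub>C u (Suc (Suc n))" for n
    proof -
      have "A (e (Suc n)) = e n + b (Suc n) *\<^sub>C e (Suc n) + a (Suc (Suc n)) *\<^sub>C e (Suc (Suc n))"
        using matrix by (auto simp: tridiagonal_in_basis_def dest: spec [of _ "Suc n"])
      then have "T (u (Suc n)) = of_real (inverse (h (Suc n))) *\<^sub>C
          (e n + b (Suc n) *\<^sub>C e (Suc n) + a (Suc (Suc n)) *\<^sub>C e (Suc (Suc n)) - z *\<^sub>C e (Suc n))"
        by (simp add: Tu)
      then show ?thesis
        using h0 [of "Suc n"]
        by (simp add: e \<alpha>_def \<beta>_def \<rho>_def scaleC.scale_right_diff_distrib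
            scaleC.scale_right_distrib scaleC.scale_left_diff_distrib field_simps)
    qed
  qed
  \<comment> \<open>The columns are constructed before it is known whether \<open>z\<close> lies in
    the resolvent set, so both directions can use them.\<close>
  have "\<exists>x. T x = - u n \<and> (\<forall>m. coeff x m = G m n)" for n
    unfolding G_def
    by (rule green_column [OF nonzero_Suc norm_pos \<alpha>_def \<beta>_def \<rho>_def square_summable])
  then obtain F where F: "\<And>n. T (F n) = - u n" "\<And>m n. coeff (F n) m = G m n"
    by metis
  have inj: "x = 0" if "T x = 0" for x
    using no_eigenvalue that by (auto simp: eigenvalue_def T_def)
  have resolvent: "z \<in> resolvent_set A \<longleftrightarrow>
      (\<exists>R. bounded_clinear R \<and> (\<forall>x. R (T x) = x) \<and> (\<forall>x. T (R x) = x))"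
    by (simp add: resolvent_set_def spectrum_def T_def)
  have "z \<in> resolvent_set A \<longleftrightarrow>
    (\<exists>C q. C > 0 \<and> 0 < q \<and> q < 1 \<and> (\<forall>m n. cmod (G m n) \<le> C * q ^ nat \<bar>int m - int n\<bar>))"
  proof
    assume "z \<in> resolvent_set A"
    then obtain R where R: "bounded_clinear R" "\<And>x. R (T x) = x"
      unfolding resolvent by blast
    then obtain K where K: "K > 0" "\<And>x. norm (R x) \<le> norm x * K"
      using bounded_linear.pos_bounded [OF bounded_clinear_linear] by blast
    \<comment> \<open>A bounded left inverse bounds \<open>T\<close> from below, which is the form
      of invertibility that the decay argument takes.\<close>
    have "norm x \<le> K * norm (T x)" for x
      using K(2) [of "T x"] by (simp add: R(2) mult.commute)
    then obtain C q where Cq: "C > 0" "0 < q" "q < 1"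
      "\<And>x m n. T x = u n \<Longrightarrow> cmod (coeff x m) \<le> C * q ^ nat \<bar>int m - int n\<bar>"
      using exponential_decay K(1) by blast
    have "cmod (G m n) \<le> C * q ^ nat \<bar>int m - int n\<bar>" for m n
    proof -
      have "T (- F n) = u n"
        using F(1) by (simp add: linear_neg bounded_linear.linear bounded_clinear_linear [OF T])
      moreover have "coeff (- F n) m = - G m n"
        using cinner_diff_left [of 0 "F n" "u m"] by (simp add: F(2))
      ultimately show ?thesis
        using Cq(4) by (metis norm_minus_cancel)
    qed
    then show "\<exists>C q. C > 0 \<and> 0 < q \<and> q < 1 \<and> (\<forall>m n. cmod (G m n) \<le> C * q ^ nat \<bar>int m - int n\<bar>)"
      using Cq by blast
  next
    assume "\<exists>C q. C > 0 \<and> 0 < q \<and> q < 1 \<and> (\<forall>m n. cmod (G m n) \<le> C * q ^ nat \<bar>int m - int n\<bar>)"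
    then obtain C q where Cq: "C > 0" "0 < q" "q < 1"
      "\<And>m n. cmod (coeff (F n) m) \<le> C * q ^ nat \<bar>int m - int n\<bar>"
      unfolding F(2) by blast
    \<comment> \<open>Decay gives preimages with a norm bound, and injectivity holds because
      \<open>z\<close> is not an eigenvalue.\<close>
    show "z \<in> resolvent_set A"
      unfolding resolvent
      by (rule bounded_clinear_inverse [OF T inj surjective_of_decaying_columns
            [OF T F(1) Cq(2,3) less_imp_le [OF Cq(1)] Cq(4)]])
  qed
  moreover have "(\<forall>m n. cmod (G m n) \<le> C * q ^ nat \<bar>int m - int n\<bar>) \<longleftrightarrow>
      (\<forall>m n. n \<le> m \<longrightarrow>
        cmod (poly (denom_poly a b n) z * remainder a b \<gamma> z m / (\<Prod>i=1..n. a i)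
              * complex_of_real (h m / h n)) \<le> C * q ^ (m - n)) \<and>
      (\<forall>m n. m \<le> n \<longrightarrow>
        cmod (poly (denom_poly a b m) z * remainder a b \<gamma> z n / (\<Prod>i=1..n. a i)
              * complex_of_real (h m / h n)) \<le> C * q ^ (n - m))" (is "?L \<longleftrightarrow> ?R") for C q
  proof -
    have dist: "n \<le> m \<Longrightarrow> nat \<bar>int m - int n\<bar> = m - n" "m \<le> n \<Longrightarrow> nat \<bar>int m - int n\<bar> = n - m"
      for m n :: nat
      by auto
    \<comment> \<open>Splitting at the diagonal removes the absolute value; the two ranges overlap
      for \<open>m = n\<close>, where the bounds agree.\<close>
    have "?L \<longleftrightarrow> (\<forall>m n. n \<le> m \<longrightarrow> cmod (G m n) \<le> C * q ^ (m - n)) \<and>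
        (\<forall>m n. m \<le> n \<longrightarrow> cmod (G m n) \<le> C * q ^ (n - m))"
      by (metis dist nle_le)
    also have "\<dots> \<longleftrightarrow> ?R"
      unfolding G_def by (simp only: green_le green_ge cong: imp_cong)
    finally show ?thesis .
  qed
  ultimately show ?thesis
    by simp
qed

end
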